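(* Let $G$ be a graph with at least one edge and let $H$ be a subdivision of $G$. Then $$\operatorname{diam}(H)\le \operatorname{diam}(G)+\log_2(\operatorname{diam}(G))+5 .$$
   Context: Graphs are finite and simple. For an oriented graph $\overrightarrow{G}$ and $X\subseteq V(\overrightarrow{G})$, the inversion of $X$ reverses every arc having both endpoints in $X$ (and no other arc). For a (labeled) graph $G$, the inversion distance between two orientations of $G$ is the minimum number of inversions transforming one into the other (equality as labeled oriented graphs), and the inversion diameter $\operatorname{diam}(G)$ is the maximum inversion distance over all pairs of orientations of $G$. A graph $H$ is a subdivision of $G$ if it can be obtained from $G$ by replacing every edge by a path on at least 2 vertices between its endpoints (paths are internally disjoint with new internal vertices; the lengths may differ for different edges, and an edge may be left unsubdivided). *)

theory Defs
  imports Complex_Main "Graph_Theory.Graph_Theory"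
begin

text \<open>
  Finite simple graphs are \<^locale>\<open>pair_graph\<close>s: an edge between \<open>u\<close> and \<open>v\<close> is the pair of
  arcs \<open>(u, v)\<close>, \<open>(v, u)\<close>. Oriented graphs use the same record type, with one arc per edge.

  Subdivisions are those of \<^theory>\<open>Graph_Theory.Subdivision\<close>: edges \<open>u v\<close> are successively
  replaced by \<open>u w v\<close> with \<open>w\<close> a new vertex, any number of times (possibly none). This replaces
  every edge of the original graph by a path, with disjoint sets of new internal vertices.
\<close>

definition orientation :: "'a pair_pre_digraph \<Rightarrow> 'a pair_pre_digraph \<Rightarrow> bool" where
  "orientation G D \<longleftrightarrow>
     pverts D = pverts G \<and> parcs D \<subseteq> parcs G \<and>
     (\<forall>u v. (u, v) \<in> parcs G \<longrightarrow> ((u, v) \<in> parcs D \<longleftrightarrow> (v, u) \<notin> parcs D))"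

definition inversion :: "'a set \<Rightarrow> 'a pair_pre_digraph \<Rightarrow> 'a pair_pre_digraph" where
  "inversion X D = \<lparr> pverts = pverts D,
     parcs = {(u, v). if u \<in> X \<and> v \<in> X then (v, u) \<in> parcs D else (u, v) \<in> parcs D} \<rparr>"

definition inversion_distance :: "'a pair_pre_digraph \<Rightarrow> 'a pair_pre_digraph \<Rightarrow> nat" where
  "inversion_distance D D' =
     (LEAST k. \<exists>Xs. length Xs = k \<and> (\<forall>X \<in> set Xs. X \<subseteq> pverts D) \<and> fold inversion Xs D = D')"

definition inversion_diameter :: "'a pair_pre_digraph \<Rightarrow> nat" where
  "inversion_diameter G =
     Max {inversion_distance D D' | D D'. orientation G D \<and> orientation G D'}"

text \<open>The minimum and the maximum above are attained, so neither defaults to a junk value.\<close>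

lemma pverts_inversion [simp]: "pverts (inversion X D) = pverts D"
  by (simp add: inversion_def)

lemma in_parcs_inversion [simp]:
  "(u, v) \<in> parcs (inversion X D) \<longleftrightarrow>
     (if u \<in> X \<and> v \<in> X then (v, u) \<in> parcs D else (u, v) \<in> parcs D)"
  by (simp add: inversion_def)

lemma orientation_inversion:
  assumes "pair_graph G" "orientation G D"
  shows "orientation G (inversion X D)"
proof -
  interpret pair_graph G by fact
  have sym: "(v, u) \<in> parcs G \<longleftrightarrow> (u, v) \<in> parcs G" for u v
    using arcs_symmetric by blast
  have D: "pverts D = pverts G" "\<And>u v. (u, v) \<in> parcs D \<Longrightarrow> (u, v) \<in> parcs G"
    "\<And>u v. (u, v) \<in> parcs G \<Longrightarrow> (u, v) \<in> parcs D \<longleftrightarrow> (v, u) \<notin> parcs D"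
    using assms(2) by (simp_all add: orientation_def subset_iff)
  have "(u, v) \<in> parcs G" if "(u, v) \<in> parcs (inversion X D)" for u v
    using that D(2)[of u v] D(2)[of v u] sym[of u v] by (simp split: if_splits)
  moreover have "(u, v) \<in> parcs (inversion X D) \<longleftrightarrow> (v, u) \<notin> parcs (inversion X D)"
    if "(u, v) \<in> parcs G" for u v
    using D(3)[OF that] by auto
  ultimately show ?thesis
    unfolding orientation_def using D(1) by (simp add: subset_iff del: in_parcs_inversion)
qed

lemma inversions_exist:
  assumes "pair_graph G" "orientation G D" "orientation G D'"
  shows "\<exists>Xs. (\<forall>X \<in> set Xs. X \<subseteq> pverts D) \<and> fold inversion Xs D = D'"
  using assms(2)
proof (induction "card (parcs D' - parcs D)" arbitrary: D rule: less_induct)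
  case less
  interpret pair_graph G by fact
  note ori = less.prems assms(3)
  show ?case
  proof (cases "parcs D' \<subseteq> parcs D")
    case True
    have "parcs D \<subseteq> parcs D'"
    proof (rule subrelI)
      fix u v assume uv: "(u, v) \<in> parcs D"
      then have "(u, v) \<in> parcs G" "(v, u) \<notin> parcs D"
        using ori(1) by (auto simp: orientation_def)
      then show "(u, v) \<in> parcs D'"
        using True ori(2) by (auto simp: orientation_def)
    qed
    then have "D = D'"
      using True ori by (simp add: orientation_def)
    then show ?thesis by (intro exI[of _ "[]"]) simp
  next
    case False
    then obtain u v where uv: "(u, v) \<in> parcs D'" "(u, v) \<notin> parcs D" by auto
    then have G: "(u, v) \<in> parcs G" and ne: "(v, u) \<notin> parcs D'"
      using ori(2) by (auto simp: orientation_def)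
    let ?E = "inversion {u, v} D"
    have vu: "(v, u) \<in> parcs D" using uv(2) G ori(1) by (auto simp: orientation_def)
    have E: "orientation G ?E" using assms(1) less.prems by (rule orientation_inversion)
    have nl: "(w, w) \<notin> parcs D'" for w
      using ori(2) by (auto simp: orientation_def)
    have "parcs D' - parcs ?E \<subset> parcs D' - parcs D"
    proof
      show "parcs D' - parcs ?E \<subseteq> parcs D' - parcs D"
        using nl ne vu uv by (auto split: if_splits)
      have "(u, v) \<in> parcs ?E" using vu by simp
      then show "parcs D' - parcs ?E \<noteq> parcs D' - parcs D" using uv by blast
    qed
    moreover have "finite (parcs D')"
      using ori(2) pair_finite_arcs finite_subset[of "parcs D'" "parcs G"]
      by (simp add: orientation_def)
    ultimately have lt: "card (parcs D' - parcs ?E) < card (parcs D' - parcs D)"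
      by (intro psubset_card_mono) auto
    from less.hyps[OF lt E] obtain Xs
      where Xs: "\<forall>X \<in> set Xs. X \<subseteq> pverts D" "fold inversion Xs ?E = D'" by auto
    have "{u, v} \<subseteq> pverts D"
      using G ori(1) in_arcsD1 in_arcsD2 by (auto simp: orientation_def)
    then have "(\<forall>X \<in> set ({u, v} # Xs). X \<subseteq> pverts D) \<and> fold inversion ({u, v} # Xs) D = D'"
      using Xs by simp
    then show ?thesis by (rule exI)
  qed
qed

lemma finite_orientations:
  assumes "pair_graph G"
  shows "finite {D. orientation G D}"
proof -
  interpret pair_graph G by fact
  have "D \<in> (\<lambda>A. \<lparr>pverts = pverts G, parcs = A\<rparr>) ` Pow (parcs G)" if "orientation G D" for D
    using that by (cases D) (simp add: orientation_def)
  then have "{D. orientation G D} \<subseteq> (\<lambda>A. \<lparr>pverts = pverts G, parcs = A\<rparr>) ` Pow (parcs G)"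
    by blast
  then show ?thesis
    by (rule finite_subset) (simp add: pair_finite_arcs)
qed

lemma orientation_exists:
  assumes "pair_graph G"
  shows "\<exists>D. orientation G D"
proof -
  interpret pair_graph G by fact
  obtain f :: "'a \<Rightarrow> nat" where f: "inj_on f (pverts G)"
    using finite_imp_inj_to_nat_seg[OF pair_finite_verts] by blast
  have "f u \<noteq> f v" if "(u, v) \<in> parcs G" for u v
  proof -
    have "u \<in> pverts G" "v \<in> pverts G" "u \<noteq> v"
      using that in_arcsD1 in_arcsD2 pair_no_loops[OF that] by simp_all
    then show ?thesis using f by (simp add: inj_on_eq_iff)
  qed
  moreover have "(v, u) \<in> parcs G" if "(u, v) \<in> parcs G" for u v
    using that by (rule arcs_symmetric)
  ultimately have "orientation G \<lparr>pverts = pverts G, parcs = {(u, v) \<in> parcs G. f u < f v}\<rparr>"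
    unfolding orientation_def
    by (simp add: subset_iff) (metis linorder_neqE_nat less_not_sym)
  then show ?thesis ..
qed

lemma finite_inversion_distances:
  assumes "pair_graph G"
  shows "finite {inversion_distance D D' | D D'. orientation G D \<and> orientation G D'}"
  by (intro finite_image_set2 finite_orientations assms)

end

theory Submission
  imports Defs
begin

text \<open>
  Identify a list of \<open>k\<close> inversions with an assignment of vectors \<open>x\<^sub>v \<in> F\<^sub>2\<^sup>k\<close> to the vertices: the
  arc between \<open>u\<close> and \<open>v\<close> is reversed iff \<open>x\<^sub>u \<cdot> x\<^sub>v = 1\<close>. So \<open>diam G \<le> k\<close> iff every
  \<open>F\<^sub>2\<close>-labelling of the edges has the form \<open>x\<^sub>u \<cdot> x\<^sub>v\<close> with vectors of length \<open>k\<close>.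

  Let \<open>t = diam G\<close>. Comparing the numbers of labellings and of vector assignments, every induced
  subgraph on \<open>s\<close> vertices has at most \<open>t s\<close> edges, so \<open>G\<close> has a proper colouring with
  \<open>2 t + 1\<close> colours. Take as colours nonzero vectors \<open>y\<^sub>v\<close> in about \<open>log\<^sub>2 t\<close> further coordinates,
  and realise the labelling corrected by \<open>y\<^sub>u \<cdot> y\<^sub>v\<close> in the first \<open>t\<close> coordinates. Then every
  labelling of \<open>G\<close> is realised by vectors that are nonzero and distinct on adjacent vertices. Over
  \<open>F\<^sub>2\<close> such vectors are linearly independent at the two ends of an edge, so a vertex \<open>w\<close>
  subdividing the edge can be given a vector with prescribed products, and in dimension at least \<open>4\<close>
  it can also be chosen nonzero and different from its two neighbours. Hence the property passes to
  subdivisions.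
\<close>

section \<open>Inversions as vectors\<close>

text \<open>Vectors over F_2 are represented by their supports and scalars by truth values:
  \<open>\<noteq>\<close> on \<open>bool\<close> is addition and \<open>{}\<close> is the zero
  vector.\<close>

definition dot :: "nat set \<Rightarrow> nat set \<Rightarrow> bool" where
  "dot A B \<longleftrightarrow> odd (card (A \<inter> B))"

lemma dot_commute: "dot A B = dot B A"
  by (simp add: dot_def Int_commute)

definition realizes ::
  "'a pair_pre_digraph \<Rightarrow> nat \<Rightarrow> ('a \<Rightarrow> 'a \<Rightarrow> bool) \<Rightarrow> ('a \<Rightarrow> nat set) \<Rightarrow> bool" where
  "realizes G k p x \<longleftrightarrow>
     (\<forall>u. x u \<subseteq> {..<k}) \<and> (\<forall>u v. (u, v) \<in> parcs G \<longrightarrow> dot (x u) (x v) = p u v)"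

lemma in_parcs_fold_inversion:
  "(u, v) \<in> parcs (fold inversion Xs D) \<longleftrightarrow>
     (if odd (length (filter (\<lambda>X. u \<in> X \<and> v \<in> X) Xs)) then (v, u) \<in> parcs D else (u, v) \<in> parcs D)"
proof (induction Xs arbitrary: D)
  case (Cons X Xs)
  show ?case by (simp add: Cons.IH)
qed simp

lemma pverts_fold_inversion [simp]: "pverts (fold inversion Xs D) = pverts D"
  by (induction Xs arbitrary: D) simp_all

lemma orientation_fold_inversion:
  assumes "pair_graph G" "orientation G D"
  shows "orientation G (fold inversion Xs D)"
  using assms(2) by (induction Xs arbitrary: D) (simp_all add: orientation_inversion assms(1))

lemma orientation_eqI:
  assumes "orientation G D" "orientation G D'"
    and "\<And>u v. (u, v) \<in> parcs G \<Longrightarrow> (u, v) \<in> parcs D \<longleftrightarrow> (u, v) \<in> parcs D'"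
  shows "D = D'"
proof -
  have "parcs D = parcs D'"
    using assms by (auto simp: orientation_def)
  then show ?thesis using assms(1,2) by (simp add: orientation_def)
qed

lemma inversion_distance_le_iff:
  assumes G: "pair_graph G" and D: "orientation G D" and D': "orientation G D'"
  shows "inversion_distance D D' \<le> k \<longleftrightarrow>
    (\<exists>x. realizes G k (\<lambda>u v. ((u, v) \<in> parcs D) \<noteq> ((u, v) \<in> parcs D')) x)"
proof
  interpret pair_graph G by fact
  have flip: "(v, u) \<in> parcs D \<longleftrightarrow> (u, v) \<notin> parcs D" if "(u, v) \<in> parcs G" for u v
    using that D by (auto simp: orientation_def)
  let ?P = "\<lambda>k. \<exists>Xs. length Xs = k \<and> (\<forall>X \<in> set Xs. X \<subseteq> pverts D) \<and> fold inversion Xs D = D'"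
  {
    assume le: "inversion_distance D D' \<le> k"
    have "\<exists>k. ?P k" using inversions_exist[OF assms] by blast
    then have "?P (inversion_distance D D')"
      unfolding inversion_distance_def by (rule LeastI_ex)
    then obtain Xs where Xs: "length Xs = inversion_distance D D'" "fold inversion Xs D = D'" by blast
    define x where "x u = {i. i < length Xs \<and> u \<in> Xs ! i}" for u
    have "dot (x u) (x v) \<longleftrightarrow> odd (length (filter (\<lambda>X. u \<in> X \<and> v \<in> X) Xs))" for u v
      unfolding dot_def length_filter_conv_card
      by (rule arg_cong[of _ _ "\<lambda>A. odd (card A)"]) (auto simp: x_def)
    then have "dot (x u) (x v) \<longleftrightarrow> (((u, v) \<in> parcs D) \<noteq> ((u, v) \<in> parcs D'))"
      if "(u, v) \<in> parcs G" for u v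
      using flip[OF that] by (simp add: Xs(2)[symmetric] in_parcs_fold_inversion)
    moreover have "x u \<subseteq> {..<k}" for u
      using le Xs(1) by (auto simp: x_def)
    ultimately show "\<exists>x. realizes G k (\<lambda>u v. ((u, v) \<in> parcs D) \<noteq> ((u, v) \<in> parcs D')) x"
      unfolding realizes_def by blast
  next
    assume "\<exists>x. realizes G k (\<lambda>u v. ((u, v) \<in> parcs D) \<noteq> ((u, v) \<in> parcs D')) x"
    then obtain x where sub: "\<And>u. x u \<subseteq> {..<k}"
      and x: "\<And>u v. (u, v) \<in> parcs G \<Longrightarrow>
                dot (x u) (x v) \<longleftrightarrow> (((u, v) \<in> parcs D) \<noteq> ((u, v) \<in> parcs D'))"
      unfolding realizes_def by blast
    \<comment> \<open>Inverted sets must consist of vertices; as arcs end in vertices, the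
      restriction changes no relevant parity.\<close>
    define Xs where "Xs = map (\<lambda>i. {u \<in> pverts D. i \<in> x u}) [0..<k]"
    have "fold inversion Xs D = D'"
    proof (rule orientation_eqI[OF orientation_fold_inversion[OF G D] D'])
      fix u v assume uv: "(u, v) \<in> parcs G"
      then have V: "u \<in> pverts D" "v \<in> pverts D"
        using D in_arcsD1 in_arcsD2 by (auto simp: orientation_def)
      have "odd (length (filter (\<lambda>X. u \<in> X \<and> v \<in> X) Xs)) \<longleftrightarrow> dot (x u) (x v)"
        unfolding dot_def length_filter_conv_card
        by (rule arg_cong[of _ _ "\<lambda>A. odd (card A)"])
          (use sub[of u] V in \<open>auto simp: Xs_def cong: conj_cong\<close>)
      then show "(u, v) \<in> parcs (fold inversion Xs D) \<longleftrightarrow> (u, v) \<in> parcs D'"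
        using x[OF uv] flip[OF uv] by (auto simp: in_parcs_fold_inversion)
    qed
    moreover have "length Xs = k" "\<forall>X \<in> set Xs. X \<subseteq> pverts D"
      by (auto simp: Xs_def)
    ultimately have "?P k" by blast
    then show "inversion_distance D D' \<le> k"
      unfolding inversion_distance_def by (rule Least_le)
  }
qed

text \<open>Every symmetric \<open>p\<close> is, on the arcs, the difference of two orientations:
  fix one and reverse exactly the arcs where \<open>p\<close> holds.\<close>

lemma inversion_diameter_le_iff:
  assumes G: "pair_graph G"
  shows "inversion_diameter G \<le> k \<longleftrightarrow> (\<forall>p. (\<forall>u v. p u v = p v u) \<longrightarrow> (\<exists>x. realizes G k p x))"
proof -
  interpret pair_graph G by fact
  have "inversion_diameter G \<le> k \<longleftrightarrow>
      (\<forall>D D'. orientation G D \<longrightarrow> orientation G D' \<longrightarrow> inversion_distance D D' \<le> k)"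
  proof -
    have "{inversion_distance D D' | D D'. orientation G D \<and> orientation G D'} \<noteq> {}"
      using orientation_exists[OF G] by blast
    then show ?thesis
      unfolding inversion_diameter_def by (subst Max_le_iff[OF finite_inversion_distances[OF G]]) auto
  qed
  also have "\<dots> \<longleftrightarrow> (\<forall>p. (\<forall>u v. p u v = p v u) \<longrightarrow> (\<exists>x. realizes G k p x))"
  proof (intro iffI allI impI)
    fix p :: "'a \<Rightarrow> 'a \<Rightarrow> bool"
    assume *: "\<forall>D D'. orientation G D \<longrightarrow> orientation G D' \<longrightarrow> inversion_distance D D' \<le> k"
      and p: "\<forall>u v. p u v = p v u"
    obtain D where D: "orientation G D" using orientation_exists[OF G] ..
    define D' where "D' = \<lparr>pverts = pverts G,
      parcs = {(u, v) \<in> parcs G. ((u, v) \<in> parcs D) \<noteq> p u v}\<rparr>"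
    have sym: "(v, u) \<in> parcs G" if "(u, v) \<in> parcs G" for u v
      using that by (rule arcs_symmetric)
    have D': "orientation G D'"
      unfolding orientation_def D'_def
    proof (intro conjI allI impI)
      fix u v assume uv: "(u, v) \<in> parcs G"
      then have "(u, v) \<in> parcs D \<longleftrightarrow> (v, u) \<notin> parcs D"
        using D by (auto simp: orientation_def)
      moreover have "p u v = p v u" using p by blast
      ultimately show "(u, v) \<in> parcs \<lparr>pverts = pverts G,
            parcs = {(u, v) \<in> parcs G. ((u, v) \<in> parcs D) \<noteq> p u v}\<rparr> \<longleftrightarrow>
          (v, u) \<notin> parcs \<lparr>pverts = pverts G,
            parcs = {(u, v) \<in> parcs G. ((u, v) \<in> parcs D) \<noteq> p u v}\<rparr>"
        using uv sym[OF uv] by simp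
    qed auto
    with * D obtain x where "realizes G k (\<lambda>u v. ((u, v) \<in> parcs D) \<noteq> ((u, v) \<in> parcs D')) x"
      using inversion_distance_le_iff[OF G D D'] by blast
    then have "realizes G k p x"
      by (auto simp: realizes_def D'_def)
    then show "\<exists>x. realizes G k p x" by (rule exI[of _ x])
  next
    fix D D'
    assume *: "\<forall>p. (\<forall>u v. p u v = p v u) \<longrightarrow> (\<exists>x. realizes G k p x)"
      and D: "orientation G D" and D': "orientation G D'"
    \<comment> \<open>Symmetry is demanded off the arcs of \<open>G\<close> too; there all four
      memberships are false.\<close>
    have "(((u, v) \<in> parcs D) \<noteq> ((u, v) \<in> parcs D')) =
        (((v, u) \<in> parcs D) \<noteq> ((v, u) \<in> parcs D'))" for u v
    proof (cases "(u, v) \<in> parcs G")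
      case True
      then show ?thesis using D D' by (auto simp: orientation_def)
    next
      case False
      then have "(v, u) \<notin> parcs G" using arcs_symmetric by blast
      with False show ?thesis using D D' by (auto simp: orientation_def)
    qed
    with * have "\<exists>x. realizes G k (\<lambda>u v. ((u, v) \<in> parcs D) \<noteq> ((u, v) \<in> parcs D')) x"
      by (elim allE[of _ "\<lambda>u v. ((u, v) \<in> parcs D) \<noteq> ((u, v) \<in> parcs D')"] impE) simp_all
    then show "inversion_distance D D' \<le> k"
      using inversion_distance_le_iff[OF G D D'] by blast
  qed
  finally show ?thesis .
qed

lemma realization_exists:
  assumes "pair_graph G" "inversion_diameter G \<le> k" "\<And>u v. p u v = p v u"
  obtains x where "realizes G k p x"
  using inversion_diameter_le_iff[OF assms(1), THEN iffD1, OF assms(2), THEN spec, THEN mp, of p] assms(3)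
  by blast

section \<open>Colourings\<close>

text \<open>Counting: each of the \<open>2 ^ card F\<close> labellings of the edges inside
  \<open>S\<close> is recovered from the vectors on \<open>S\<close>, for which there are
  \<open>2 ^ (?t * card S)\<close> choices. The factor 2 is there because an edge is two
  arcs.\<close>

lemma card_arcs_le:
  assumes G: "pair_graph G" and S: "S \<subseteq> pverts G"
  shows "card (parcs G \<inter> S \<times> S) \<le> 2 * inversion_diameter G * card S"
proof -
  interpret pair_graph G by fact
  let ?t = "inversion_diameter G"
  obtain D where D: "orientation G D" using orientation_exists[OF G] ..
  define F where "F = parcs D \<inter> S \<times> S"
  have finS: "finite S" using S pair_finite_verts finite_subset by blast
  then have finF: "finite F" by (simp add: F_def)
  have "Pow F \<subseteq> (\<lambda>x. {(u, v) \<in> F. dot (x u) (x v)}) ` (S \<rightarrow>\<^sub>E Pow {..<?t})"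
  proof
    fix L assume "L \<in> Pow F"
    then have L: "L \<subseteq> F" by simp
    obtain x where x: "realizes G ?t (\<lambda>u v. (u, v) \<in> L \<or> (v, u) \<in> L) x"
      by (rule realization_exists[OF G order_refl, of "\<lambda>u v. (u, v) \<in> L \<or> (v, u) \<in> L"]) blast+
    have dot: "(u, v) \<in> L \<longleftrightarrow> dot (x u) (x v)" if "(u, v) \<in> F" for u v
    proof -
      have "(u, v) \<in> parcs G" "(v, u) \<notin> parcs D"
        using that D by (auto simp: F_def orientation_def)
      moreover from this have "(v, u) \<notin> L" using L by (auto simp: F_def)
      ultimately show ?thesis using x by (auto simp: realizes_def)
    qed
    have "(u, v) \<in> L \<longleftrightarrow> (u, v) \<in> F \<and> dot (restrict x S u) (restrict x S v)" for u v
    proof (cases "(u, v) \<in> F")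
      case True
      then show ?thesis using dot[OF True] by (simp add: F_def)
    next
      case False
      then show ?thesis using L by blast
    qed
    then have "L = {(u, v) \<in> F. dot (restrict x S u) (restrict x S v)}" by auto
    moreover have "restrict x S \<in> S \<rightarrow>\<^sub>E Pow {..<?t}"
      using x by (auto simp: realizes_def)
    ultimately show "L \<in> (\<lambda>x. {(u, v) \<in> F. dot (x u) (x v)}) ` (S \<rightarrow>\<^sub>E Pow {..<?t})"
      by blast
  qed
  then have "card (Pow F) \<le> card (S \<rightarrow>\<^sub>E Pow {..<?t})"
    by (rule surj_card_le[rotated]) (simp add: finS finite_PiE)
  then have "(2::nat) ^ card F \<le> 2 ^ (?t * card S)"
    by (simp add: card_Pow finF card_PiE finS power_mult)
  then have F: "card F \<le> ?t * card S"
    by simp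
  have "parcs G \<inter> S \<times> S \<subseteq> F \<union> prod.swap ` F"
  proof (rule subrelI)
    fix u v assume uv: "(u, v) \<in> parcs G \<inter> S \<times> S"
    then have "(u, v) \<in> parcs D \<or> (v, u) \<in> parcs D"
      using D unfolding orientation_def by blast
    then have "(u, v) \<in> F \<or> (v, u) \<in> F" using uv by (auto simp: F_def)
    then show "(u, v) \<in> F \<union> prod.swap ` F" by force
  qed
  then have "card (parcs G \<inter> S \<times> S) \<le> card (F \<union> prod.swap ` F)"
    by (rule card_mono[rotated]) (simp add: finF)
  also have "\<dots> \<le> card F + card (prod.swap ` F)"
    by (rule card_Un_le)
  also have "\<dots> \<le> card F + card F"
    using card_image_le[OF finF] by simp
  finally show ?thesis using F by simp
qed

text \<open>Greedy colouring: by \<open>card_arcs_le\<close> the average degree inside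
  \<open>S\<close> is at most twice the diameter, so some \<open>u\<close> has at most that many
  neighbours in \<open>S\<close>. Colour the rest by induction; a colour is left for
  \<open>u\<close>.\<close>

lemma colouring_exists:
  assumes G: "pair_graph G" and "finite C" and C: "2 * inversion_diameter G < card C"
    and S: "S \<subseteq> pverts G"
  shows "\<exists>c. c ` S \<subseteq> C \<and> (\<forall>(u, v) \<in> parcs G \<inter> S \<times> S. c u \<noteq> c v)"
  using S
proof (induction "card S" arbitrary: S)
  case 0
  interpret pair_graph G by fact
  have "S = {}" using 0 finite_subset[OF _ pair_finite_verts] by simp
  then show ?case by simp
next
  case (Suc n)
  interpret pair_graph G by fact
  let ?t = "inversion_diameter G"
  let ?N = "\<lambda>u. {v \<in> S. (u, v) \<in> parcs G}"
  have finS: "finite S" using Suc.prems pair_finite_verts finite_subset by blast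
  have "\<exists>u \<in> S. card (?N u) \<le> 2 * ?t"
  proof (rule ccontr)
    assume "\<not> ?thesis"
    then have *: "2 * ?t + 1 \<le> card (?N u)" if "u \<in> S" for u
      using that by (simp add: not_le Suc_le_eq)
    have "(2 * ?t + 1) * card S = (\<Sum>u\<in>S. 2 * ?t + 1)" by simp
    also have "\<dots> \<le> (\<Sum>u\<in>S. card (?N u))" by (rule sum_mono) (rule *)
    also have "\<dots> = card (SIGMA u:S. ?N u)" using finS by (simp add: card_SigmaI)
    also have "(SIGMA u:S. ?N u) = parcs G \<inter> S \<times> S" by auto
    also have "card (parcs G \<inter> S \<times> S) \<le> 2 * ?t * card S"
      using G Suc.prems by (rule card_arcs_le)
    finally show False using Suc.hyps(2) by simp
  qed
  then obtain u where u: "u \<in> S" "card (?N u) \<le> 2 * ?t" by blast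
  have "n = card (S - {u})" using Suc.hyps(2) u(1) finS by simp
  moreover have "S - {u} \<subseteq> pverts G" using Suc.prems by blast
  ultimately have "\<exists>c. c ` (S - {u}) \<subseteq> C \<and>
      (\<forall>(v, w) \<in> parcs G \<inter> (S - {u}) \<times> (S - {u}). c v \<noteq> c w)"
    by (rule Suc.hyps(1))
  then obtain c where c': "c ` (S - {u}) \<subseteq> C \<and>
      (\<forall>(v, w) \<in> parcs G \<inter> (S - {u}) \<times> (S - {u}). c v \<noteq> c w)"
    by (rule exE)
  then have c: "c ` (S - {u}) \<subseteq> C"
    "\<And>v w. (v, w) \<in> parcs G \<Longrightarrow> v \<in> S - {u} \<Longrightarrow> w \<in> S - {u} \<Longrightarrow> c v \<noteq> c w"
    by blast+
  have "card (c ` ?N u) \<le> card (?N u)" using finS by (simp add: card_image_le)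
  then have "card (c ` ?N u) < card C" using u(2) C by linarith
  then have "\<not> C \<subseteq> c ` ?N u" using card_mono[of "c ` ?N u" C] finS by auto
  then obtain a where a: "a \<in> C" "a \<notin> c ` ?N u" by blast
  have "(c(u := a)) v \<noteq> (c(u := a)) w" if vw: "(v, w) \<in> parcs G" "v \<in> S" "w \<in> S" for v w
  proof -
    have "v \<noteq> w" using vw(1) no_loops' by blast
    moreover have "w \<in> ?N u" if "v = u" using that vw by simp
    moreover have "v \<in> ?N u" if "w = u" using that vw arcs_symmetric by blast
    ultimately show ?thesis using a(2) c(2)[OF vw(1)] vw(2,3) by (cases "v = u"; cases "w = u") auto
  qed
  moreover have "(c(u := a)) ` S \<subseteq> C" using c(1) a(1) by auto
  ultimately show ?case by (intro exI[of _ "c(u := a)"] conjI) blast+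
qed

section \<open>Realisations that survive subdivision\<close>

text \<open>The dimension \<open>k\<close> stays fixed along the induction over subdivisions, so the
  extra coordinates are paid for only once, at \<open>G\<close>.\<close>

definition robust :: "'a pair_pre_digraph \<Rightarrow> nat \<Rightarrow> bool" where
  "robust G k \<longleftrightarrow> (\<forall>p. (\<forall>u v. p u v = p v u) \<longrightarrow>
     (\<exists>x. realizes G k p x \<and> (\<forall>(u, v) \<in> parcs G. x u \<noteq> {} \<and> x v \<noteq> {} \<and> x u \<noteq> x v)))"

lemma dot_Un:
  assumes "A \<union> A' \<subseteq> {..<t}" "B \<union> B' \<subseteq> {t..<k}"
  shows "dot (A \<union> B) (A' \<union> B') \<longleftrightarrow> dot A A' \<noteq> dot B B'"
proof -
  have "(A \<union> B) \<inter> (A' \<union> B') = (A \<inter> A') \<union> (B \<inter> B')"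
    using assms by fastforce
  moreover have "card ((A \<inter> A') \<union> (B \<inter> B')) = card (A \<inter> A') + card (B \<inter> B')"
  proof (rule card_Un_disjoint)
    show "finite (A \<inter> A')" "finite (B \<inter> B')"
      using assms by (auto intro: finite_subset[of _ "{..<t}"] finite_subset[of _ "{t..<k}"])
    show "(A \<inter> A') \<inter> (B \<inter> B') = {}" using assms by fastforce
  qed
  ultimately show ?thesis by (simp add: dot_def)
qed

text \<open>The last \<open>k - t\<close> coordinates carry \<open>2 ^ (k - t) - 1\<close> nonzero
  vectors, which by \<open>k\<close> are enough colours.\<close>

lemma robust_if_diameter:
  assumes G: "pair_graph G" and t: "t = inversion_diameter G" and k: "2 * t + 1 < 2 ^ (k - t)"
  shows "robust G k"
  unfolding robust_def
proof (intro allI impI)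
  interpret pair_graph G by fact
  fix p :: "'a \<Rightarrow> 'a \<Rightarrow> bool"
  assume p: "\<forall>u v. p u v = p v u"
  define C where "C = Pow {t..<k} - {{}}"
  have "finite C" by (simp add: C_def)
  moreover have "card C = 2 ^ (k - t) - 1"
    by (simp add: C_def card_Diff_singleton card_Pow)
  moreover from this have "2 * inversion_diameter G < card C" using k t by linarith
  ultimately obtain c where *: "c ` pverts G \<subseteq> C"
    "\<forall>(u, v) \<in> parcs G \<inter> pverts G \<times> pverts G. c u \<noteq> c v"
    using colouring_exists[OF G, of C "pverts G"] by blast
  from *(1) have c: "c u \<subseteq> {t..<k} \<and> c u \<noteq> {}" if "u \<in> pverts G" for u
    using that by (auto simp: C_def)
  have c_neq: "c u \<noteq> c v" if "(u, v) \<in> parcs G" for u v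
    using that in_arcsD1[OF that] in_arcsD2[OF that] *(2) by blast
  \<comment> \<open>Zero off the vertices, since \<open>realizes\<close> bounds vectors on the whole
    type.\<close>
  define y where "y u = (if u \<in> pverts G then c u else {})" for u
  have sub: "y u \<subseteq> {t..<k}" for u using c by (simp add: y_def)
  have y: "y u \<noteq> {} \<and> y v \<noteq> {} \<and> y u \<noteq> y v" if "(u, v) \<in> parcs G" for u v
    using c[of u] c[of v] c_neq[OF that] in_arcsD1[OF that] in_arcsD2[OF that] by (simp add: y_def)
  have "(p u v \<noteq> dot (y u) (y v)) = (p v u \<noteq> dot (y v) (y u))" for u v
    using p dot_commute by metis
  then obtain x where "realizes G t (\<lambda>u v. p u v \<noteq> dot (y u) (y v)) x"
    by (rule realization_exists[OF G eq_refl[OF t[symmetric]]])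
  then have x: "\<And>u. x u \<subseteq> {..<t}"
    "\<And>u v. (u, v) \<in> parcs G \<Longrightarrow> dot (x u) (x v) \<longleftrightarrow> (p u v \<noteq> dot (y u) (y v))"
    by (auto simp: realizes_def)
  \<comment> \<open>Truncated subtraction: for \<open>k < t\<close> the assumption would read
    \<open>2 * t + 1 < 1\<close>.\<close>
  have "t \<le> k"
    using k by (cases "t \<le> k") simp_all
  then have "x u \<union> y u \<subseteq> {..<k}" for u
    using x(1)[of u] sub[of u] by fastforce
  moreover have "dot (x u \<union> y u) (x v \<union> y v) = p u v" if "(u, v) \<in> parcs G" for u v
    using dot_Un[of "x u" "x v" t "y u" "y v" k] x(1) x(2)[OF that] sub by auto
  ultimately have "realizes G k p (\<lambda>u. x u \<union> y u)" by (simp add: realizes_def)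
  \<comment> \<open>Projecting to the last block recovers the colour, so being nonzero and distinct
    carries over from \<open>y\<close>.\<close>
  moreover have "(x u \<union> y u) \<inter> {t..<k} = y u" for u
    using x(1)[of u] sub[of u] by fastforce
  then have "x u \<union> y u \<noteq> {} \<and> x v \<union> y v \<noteq> {} \<and> x u \<union> y u \<noteq> x v \<union> y v" if "(u, v) \<in> parcs G" for u v
    using y[OF that] by (metis Un_empty)
  ultimately show "\<exists>x. realizes G k p x \<and> (\<forall>(u, v) \<in> parcs G. x u \<noteq> {} \<and> x v \<noteq> {} \<and> x u \<noteq> x v)"
    by (intro exI[of _ "\<lambda>u. x u \<union> y u"]) auto
qed

section \<open>Vectors for subdividing vertices\<close>

lemma dot_insert:
  assumes "finite R" "i \<notin> R"
  shows "dot (insert i R) A \<longleftrightarrow> (dot R A \<noteq> (i \<in> A))"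
  using assms by (simp add: dot_def Int_insert_left)

text \<open>Choose the part \<open>R\<close> of \<open>X\<close> off \<open>i\<close> and
  \<open>j\<close> first: at least 2 coordinates remain, so one of the at least 4 choices avoids the
  traces of \<open>{}\<close>, \<open>A\<close> and \<open>B\<close>. Then \<open>j\<close> corrects
  the product with \<open>B\<close>, and afterwards \<open>i\<close> corrects that with
  \<open>A\<close> without affecting \<open>B\<close>.\<close>

lemma ex_vector_aux:
  assumes "i \<in> A" "i \<notin> B" "j \<in> B" "A \<union> B \<subseteq> {..<k}" "4 \<le> k"
  shows "\<exists>X \<subseteq> {..<k}. dot X A = a \<and> dot X B = b \<and> X \<noteq> {} \<and> X \<noteq> A \<and> X \<noteq> B"
proof -
  have ij: "i < k" "j < k" "i \<noteq> j" using assms by auto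
  let ?R = "{..<k} - {i, j}"
  have "card ?R = k - 2" using ij by (simp add: card_Diff_subset)
  then have "2 \<le> card ?R" using assms(5) by simp
  then have "(2::nat) ^ 2 \<le> 2 ^ card ?R" by (rule power_increasing) simp
  then have "4 \<le> card (Pow ?R)" by (simp add: card_Pow)
  moreover have "card {{}, A - {i, j}, B - {i, j}} \<le> 3"
    by (simp add: card_insert_if)
  ultimately have "\<not> Pow ?R \<subseteq> {{}, A - {i, j}, B - {i, j}}"
    using card_mono[of "{{}, A - {i, j}, B - {i, j}}" "Pow ?R"] by fastforce
  then obtain R where R: "R \<subseteq> ?R" "R \<notin> {{}, A - {i, j}, B - {i, j}}" by blast
  have finR: "finite R" using R(1) finite_subset by blast
  define R' where "R' = (if dot R B = b then R else insert j R)"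
  have "j \<notin> R" "i \<notin> R" using R(1) by auto
  then have R': "dot R' B = b" "i \<notin> R'" "finite R'"
    using assms(3) ij finR by (auto simp: R'_def dot_insert)
  define X where "X = (if dot R' A = a then R' else insert i R')"
  have "dot X A = a" "dot X B = b"
    using R' assms(1,2) by (auto simp: X_def dot_insert)
  moreover have "X - {i, j} = R" "X \<subseteq> {..<k}"
    using R(1) ij by (auto simp: X_def R'_def)
  ultimately show ?thesis using R(2) by (intro exI[of _ X]) auto
qed

lemma ex_vector:
  assumes "A \<noteq> {}" "B \<noteq> {}" "A \<noteq> B" "A \<union> B \<subseteq> {..<k}" "4 \<le> k"
  shows "\<exists>X \<subseteq> {..<k}. dot X A = a \<and> dot X B = b \<and> X \<noteq> {} \<and> X \<noteq> A \<and> X \<noteq> B"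
proof (cases "A \<subseteq> B")
  case False
  then obtain i j where "i \<in> A" "i \<notin> B" "j \<in> B" using assms(2) by blast
  then show ?thesis using ex_vector_aux assms(4,5) by metis
next
  case True
  then obtain i j where "i \<in> B" "i \<notin> A" "j \<in> A" using assms(1,3) by blast
  then show ?thesis using ex_vector_aux[of i B A j k b a] assms(4,5) by (metis Un_commute)
qed

lemma robust_subdivide:
  assumes H: "pair_graph H" and k: "4 \<le> k" and rob: "robust H k"
    and e: "(u, v) \<in> parcs H" and w: "w \<notin> pverts H"
  shows "robust (subdivide H (u, v) w) k"
  unfolding robust_def
proof (intro allI impI)
  interpret pair_graph H by fact
  fix p :: "'a \<Rightarrow> 'a \<Rightarrow> bool"
  assume p: "\<forall>u v. p u v = p v u"
  \<comment> \<open>The labelling of the subdivided graph is used on \<open>H\<close> as well. Its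
    value at the edge \<open>u v\<close> is harmless, as that edge disappears.\<close>
  obtain x where "realizes H k p x \<and> (\<forall>(u, v) \<in> parcs H. x u \<noteq> {} \<and> x v \<noteq> {} \<and> x u \<noteq> x v)"
    using rob[unfolded robust_def, THEN spec, THEN mp, OF p] by (rule exE)
  then have x: "realizes H k p x"
    "\<And>u v. (u, v) \<in> parcs H \<Longrightarrow> x u \<noteq> {} \<and> x v \<noteq> {} \<and> x u \<noteq> x v"
    by blast+
  have "x u \<union> x v \<subseteq> {..<k}" using x(1) by (simp add: realizes_def)
  then obtain X where X: "X \<subseteq> {..<k}" "dot X (x u) = p w u" "dot X (x v) = p w v"
    "X \<noteq> {}" "X \<noteq> x u" "X \<noteq> x v"
    using ex_vector[of "x u" "x v" k "p w u" "p w v"] x(2)[OF e] k by blast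
  have uvw: "u \<noteq> w" "v \<noteq> w" using e w in_arcsD1 in_arcsD2 by blast+
  have noarc: "(a, b) \<in> parcs H \<Longrightarrow> a \<noteq> w \<and> b \<noteq> w" for a b
    using w in_arcsD1 in_arcsD2 by blast
  let ?x = "x(w := X)"
  have "realizes (subdivide H (u, v) w) k p ?x"
    using x(1) X(1-3) uvw noarc p dot_commute[of X] by (auto simp: realizes_def)
  moreover have "\<forall>(a, b) \<in> parcs (subdivide H (u, v) w). ?x a \<noteq> {} \<and> ?x b \<noteq> {} \<and> ?x a \<noteq> ?x b"
    using x(2) x(2)[OF e] X(4-6) uvw noarc by auto
  ultimately show "\<exists>x. realizes (subdivide H (u, v) w) k p x \<and>
      (\<forall>(a, b) \<in> parcs (subdivide H (u, v) w). x a \<noteq> {} \<and> x b \<noteq> {} \<and> x a \<noteq> x b)"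
    by (intro exI[of _ ?x] conjI)
qed

lemma robust_subdivision:
  assumes "subdivision_pair G H" and G: "pair_graph G" and "robust G k" "4 \<le> k"
  shows "robust H k"
  using assms(1)
proof (induction rule: subdivision_pair_induct)
  case base
  show ?case by fact
next
  case (divide e w H)
  have "pair_graph H" using G divide.hyps(3) by (rule pair_graph.pair_graph_subdivision)
  then show ?case
    using divide robust_subdivide[of H k "fst e" "snd e" w] assms(4) by simp
qed

section \<open>Return to the diameter and the numerical bound\<close>

lemma inversion_diameter_le_if_robust:
  fixes G :: "'a pair_pre_digraph"
  assumes "pair_graph G" "robust G k"
  shows "inversion_diameter G \<le> k"
  unfolding inversion_diameter_le_iff[OF assms(1)]
proof (intro allI impI)
  fix p :: "'a \<Rightarrow> 'a \<Rightarrow> bool"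
  assume p: "\<forall>u v. p u v = p v u"
  from assms(2)[unfolded robust_def, THEN spec, THEN mp, OF p]
  show "\<exists>x. realizes G k p x" by (elim exE conjE) (rule exI)
qed

text \<open>In dimension 0 all products vanish, so an arc labelled \<open>True\<close> cannot be
  realised.\<close>

lemma inversion_diameter_pos:
  assumes G: "pair_graph G" and "parcs G \<noteq> {}"
  shows "0 < inversion_diameter G"
proof (rule ccontr)
  assume "\<not> 0 < inversion_diameter G"
  then obtain x where "realizes G 0 (\<lambda>_ _. True) x"
    using realization_exists[OF G, of 0 "\<lambda>_ _. True"] by auto
  then show False using assms(2) by (auto simp: realizes_def dot_def)
qed

theorem theorem1p5:
  fixes G H :: "'a pair_pre_digraph"
  assumes "pair_graph G"
    and "parcs G \<noteq> {}"
    and "subdivision_pair G H"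
  shows "real (inversion_diameter H)
    \<le> real (inversion_diameter G) + log 2 (real (inversion_diameter G)) + 5"
proof -
  define t where "t = inversion_diameter G"
  define m where "m = nat \<lfloor>log 2 (real t)\<rfloor>"
  have t: "0 < t" using inversion_diameter_pos assms(1,2) by (simp add: t_def)
  then have log0: "0 \<le> log 2 (real t)" by simp
  have "log 2 (real t) < real (m + 1)" using log0 unfolding m_def by linarith
  then have "real t < 2 powr real (m + 1)" using t by (subst (asm) log_less_iff) simp_all
  also have "2 powr real (m + 1) = real (2 ^ (m + 1))" by (subst powr_realpow) simp_all
  finally have "t < 2 ^ (m + 1)" by (simp only: of_nat_less_iff)
  \<comment> \<open>The colours need only \<open>2 * t + 1 < 2 ^ (m + 2)\<close>; the summand
    \<open>5\<close> also makes the dimension at least 4, as \<open>ex_vector\<close>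
    requires.\<close>
  then have "2 * t + 1 < 2 ^ (t + m + 5 - t)" by (simp add: power_add)
  then have "robust G (t + m + 5)"
    by (rule robust_if_diameter[OF assms(1) t_def])
  then have "robust H (t + m + 5)"
    using robust_subdivision[OF assms(3,1)] by simp
  then have "inversion_diameter H \<le> t + m + 5"
    by (rule inversion_diameter_le_if_robust[OF pair_graph.pair_graph_subdivision[OF assms(1,3)]])
  moreover have "real m \<le> log 2 (real t)" using log0 by (simp add: m_def)
  ultimately show ?thesis unfolding t_def by linarith
qed

end
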